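(* Let $n\ge 3$ and $N=\{1,2,\dots,n\}$. If an $n\times n$ matrix $A=[a_{ij}]$ is the crossing matrix of a reducible pure $n$-braid, then there exists a subset $S$ of $N$ with $1<|S|<n$ such that for any $k\in N\setminus S$, $a_{kl}=a_{kl'}$ for some distinct $l,l'\in S$.
   Context: $\mathcal{B}_n$ denotes the braid group on $n$ strands; an $n$-braid has $n$ strands running monotonically from an upper bar to a lower bar, and the product $bb'$ is $b$ placed above $b'$. The $i$-th strand is the one whose upper endpoint is in the $i$-th position from the left. A braid is pure if for every $i$ the $i$-th strand ends at the $i$-th position of the lower bar. In $\sigma_i$ the strands in positions $i$ and $i+1$ cross once, the strand going from position $i+1$ to position $i$ passing over; this crossing has sign $+1$. In $\sigma_i^{-1}$ the strand going from position $i$ to position $i+1$ passes over, and the crossing has sign $-1$. The crossing matrix $C(b)=[m_{ij}]$ of an $n$-braid $b$ is the $n\times n$ integer matrix with $m_{ii}=0$ and, for $i\ne j$, $m_{ij}$ equal to the sum of the signs of the crossings, in a diagram of $b$, at which the $i$-th strand is over the $j$-th strand. It does not depend on the diagram. Reducible is meant in the Nielsen–Thurston sense: regarding an $n$-braid as a mapping class of the $n$-punctured disk, it is reducible if it preserves, up to isotopy, a nonempty family of pairwise disjoint essential simple closed curves, where essential means enclosing at least $2$ and at most $n-1$ punctures. In particular, every periodic pure $n$-braid with $n\ge 3$ (including the trivial braid) is reducible. *)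

theory Defs
  imports "HOL-Analysis.Analysis"
begin

section \<open>Braids\<close>

text \<open>\<open>Sig i\<close> and \<open>SigInv i\<close> stand for the Artin generator \<open>\<sigma>\<^sub>i\<close> and its inverse; positions and
  strands are numbered from 1. A word is read from left to right, i.e. from the upper bar of its
  diagram to the lower bar.\<close>

datatype letter = Sig nat | SigInv nat

definition letters :: "nat \<Rightarrow> letter set" where
  "letters n = Sig ` {1..<n} \<union> SigInv ` {1..<n}"

inductive braid_eq :: "nat \<Rightarrow> letter list \<Rightarrow> letter list \<Rightarrow> bool" for n where
  refl: "w \<in> lists (letters n) \<Longrightarrow> braid_eq n w w"
| sym: "braid_eq n u v \<Longrightarrow> braid_eq n v u"
| trans: "braid_eq n u v \<Longrightarrow> braid_eq n v w \<Longrightarrow> braid_eq n u w"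
| cong: "braid_eq n u v \<Longrightarrow> braid_eq n u' v' \<Longrightarrow> braid_eq n (u @ u') (v @ v')"
| inv_right: "i \<in> {1..<n} \<Longrightarrow> braid_eq n [Sig i, SigInv i] []"
| inv_left: "i \<in> {1..<n} \<Longrightarrow> braid_eq n [SigInv i, Sig i] []"
| far: "i \<in> {1..<n} \<Longrightarrow> j \<in> {1..<n} \<Longrightarrow> Suc i < j \<Longrightarrow> braid_eq n [Sig i, Sig j] [Sig j, Sig i]"
| near: "i \<in> {1..<n} \<Longrightarrow> Suc i \<in> {1..<n} \<Longrightarrow>
    braid_eq n [Sig i, Sig (Suc i), Sig i] [Sig (Suc i), Sig i, Sig (Suc i)]"

text \<open>The underlying set of the braid group on \<open>n\<close> strands, by Artin's presentation.\<close>

definition braids :: "nat \<Rightarrow> letter list set set" where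
  "braids n = lists (letters n) // {(u, v). braid_eq n u v}"

section \<open>Purity and the crossing matrix\<close>

text \<open>An arrangement maps each position to the strand currently occupying it.\<close>

definition exchange :: "nat \<Rightarrow> (nat \<Rightarrow> nat) \<Rightarrow> nat \<Rightarrow> nat" where
  "exchange i s = s(i := s (Suc i), Suc i := s i)"

fun arrangement :: "(nat \<Rightarrow> nat) \<Rightarrow> letter list \<Rightarrow> nat \<Rightarrow> nat" where
  "arrangement s [] = s"
| "arrangement s (Sig i # w) = arrangement (exchange i s) w"
| "arrangement s (SigInv i # w) = arrangement (exchange i s) w"

text \<open>\<open>crossings s w k l\<close> is the sum of the signs of the crossings of strand \<open>k\<close> over strand \<open>l\<close>
  in the diagram \<open>w\<close> entered with arrangement \<open>s\<close>. In \<open>\<sigma>\<^sub>i\<close> the strand coming from position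
  \<open>i + 1\<close> is the upper one, in \<open>\<sigma>\<^sub>i\<^sup>-\<^sup>1\<close> the one coming from position \<open>i\<close>.\<close>

fun crossings :: "(nat \<Rightarrow> nat) \<Rightarrow> letter list \<Rightarrow> nat \<Rightarrow> nat \<Rightarrow> int" where
  "crossings s [] k l = 0"
| "crossings s (Sig i # w) k l =
     (if k = s (Suc i) \<and> l = s i then 1 else 0) + crossings (exchange i s) w k l"
| "crossings s (SigInv i # w) k l =
     (if k = s i \<and> l = s (Suc i) then - 1 else 0) + crossings (exchange i s) w k l"

text \<open>Both notions are independent of the chosen diagram, see below.\<close>

definition pure_braid :: "letter list set \<Rightarrow> bool" where
  "pure_braid b \<longleftrightarrow> arrangement id (SOME w. w \<in> b) = id"

definition crossing_matrix :: "letter list set \<Rightarrow> nat \<Rightarrow> nat \<Rightarrow> int" where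
  "crossing_matrix b = crossings id (SOME w. w \<in> b)"

lemma arrangement_append: "arrangement s (u @ v) = arrangement (arrangement s u) v"
  by (induction s u rule: arrangement.induct) auto

lemma crossings_append:
  "crossings s (u @ v) k l = crossings s u k l + crossings (arrangement s u) v k l"
  by (induction s u k l rule: crossings.induct) auto

lemma exchange_twice [simp]: "exchange i (exchange i s) = s"
  by (auto simp: exchange_def)

lemma braid_eq_invariant:
  assumes "braid_eq n u v"
  shows "arrangement s u = arrangement s v \<and> crossings s u = crossings s v"
  using assms
proof (induction arbitrary: s)
  case (cong u v u' v')
  have "arrangement s (u @ u') = arrangement s (v @ v')"
    using cong.IH by (simp add: arrangement_append)
  moreover have "crossings s (u @ u') k l = crossings s (v @ v') k l" for k l
    using cong.IH by (simp add: crossings_append)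
  ultimately show ?case by (simp add: fun_eq_iff)
qed (auto simp: fun_eq_iff exchange_def)

lemma braid_eq_lists: "braid_eq n u v \<Longrightarrow> u \<in> lists (letters n) \<and> v \<in> lists (letters n)"
  by (induction rule: braid_eq.induct) (auto simp: letters_def)

lemma equiv_braid_eq: "equiv (lists (letters n)) {(u, v). braid_eq n u v}"
  by (rule equivI)
    (auto simp: refl_on_def sym_def trans_def dest: braid_eq_lists
      intro: braid_eq.refl braid_eq.sym braid_eq.trans)

lemma braids_eq:
  assumes "b \<in> braids n" "u \<in> b" "v \<in> b"
  shows "braid_eq n u v"
  using quotient_eq_iff[OF equiv_braid_eq assms(1)[unfolded braids_def] assms(1)[unfolded braids_def]
      assms(2,3)] by simp

lemma pure_braid_iff:
  assumes "b \<in> braids n" "w \<in> b"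
  shows "pure_braid b \<longleftrightarrow> arrangement id w = id"
  unfolding pure_braid_def
  using braid_eq_invariant[OF braids_eq[OF assms(1,2) someI[of "\<lambda>w. w \<in> b", OF assms(2)]]] by simp

lemma crossing_matrix_eq:
  assumes "b \<in> braids n" "w \<in> b"
  shows "crossing_matrix b = crossings id w"
  unfolding crossing_matrix_def
  using braid_eq_invariant[OF braids_eq[OF assms(1,2) someI[of "\<lambda>w. w \<in> b", OF assms(2)]]] by simp

section \<open>Braids as mapping classes of the punctured disk\<close>

definition disk :: "nat \<Rightarrow> complex set" where
  "disk n = cball (of_real ((real n + 1) / 2)) ((real n + 1) / 2)"

definition punctures :: "nat \<Rightarrow> complex set" where
  "punctures n = of_nat ` {1..n}"

definition punctured_disk_homeo :: "nat \<Rightarrow> (complex \<Rightarrow> complex) \<Rightarrow> bool" where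
  "punctured_disk_homeo n h \<longleftrightarrow> (\<exists>g. homeomorphism (disk n) (disk n) h g) \<and>
     (\<forall>z\<in>frontier (disk n). h z = z) \<and> h ` punctures n = punctures n"

text \<open>\<open>half_twist e i\<close> rotates the disk of radius \<open>1/2\<close> about \<open>i + 1/2\<close> by the angle \<open>e * pi\<close> and
  is the identity outside the concentric disk of radius 1, which contains no punctures other than
  \<open>i\<close> and \<open>i + 1\<close>.\<close>

definition half_twist :: "real \<Rightarrow> nat \<Rightarrow> complex \<Rightarrow> complex" where
  "half_twist e i z = (let c = of_real (real i + 1 / 2) in
     c + (z - c) * cis (e * pi * max 0 (min 1 (2 - 2 * norm (z - c)))))"

text \<open>The disk is a horizontal cross-section seen from the upper bar, with the viewer of the
  diagram on the side of negative imaginary parts. The strand that passes over in \<open>\<sigma>\<^sub>i\<close> goes from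
  \<open>i + 1\<close> to \<open>i\<close> through negative imaginary parts, so \<open>\<sigma>\<^sub>i\<close> is the clockwise half twist. The
  upper braid of a product acts first.\<close>

fun letter_homeo :: "letter \<Rightarrow> complex \<Rightarrow> complex" where
  "letter_homeo (Sig i) = half_twist (- 1) i"
| "letter_homeo (SigInv i) = half_twist 1 i"

fun braid_homeo :: "letter list \<Rightarrow> complex \<Rightarrow> complex" where
  "braid_homeo [] = id"
| "braid_homeo (x # w) = braid_homeo w \<circ> letter_homeo x"

lemma half_twist_far: "1 \<le> norm (z - of_real (real i + 1 / 2)) \<Longrightarrow> half_twist e i z = z"
  by (auto simp: half_twist_def Let_def max_def min_def)

lemma norm_half_twist:
  "norm (half_twist e i z - of_real (real i + 1 / 2)) = norm (z - of_real (real i + 1 / 2))"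
  by (simp add: half_twist_def Let_def norm_mult del: of_real_add of_real_divide)

lemma half_twist_inverse: "half_twist (- e) i (half_twist e i z) = z"
proof -
  have "half_twist (- e) i (half_twist e i z) = of_real (real i + 1 / 2) +
      (half_twist e i z - of_real (real i + 1 / 2)) *
      cis (- e * pi * max 0 (min 1 (2 - 2 * norm (z - of_real (real i + 1 / 2)))))"
    by (subst half_twist_def) (simp only: Let_def norm_half_twist)
  also have "\<dots> = z"
    by (simp add: half_twist_def Let_def mult.assoc cis_mult del: of_real_add of_real_divide)
  finally show ?thesis .
qed

lemma continuous_half_twist: "continuous_on A (half_twist e i)"
  unfolding half_twist_def Let_def cis_conv_exp
  by (intro continuous_intros)

lemma norm_disk_centre:
  assumes "i \<in> {1..<n}"
  shows "dist (of_real ((real n + 1) / 2) :: complex) (of_real (real i + 1 / 2)) \<le> (real n + 1) / 2 - 3 / 2"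
proof -
  have "1 \<le> real i" "real i + 1 \<le> real n" using assms by auto
  then show ?thesis
    by (simp only: dist_of_real dist_real_def) (simp add: abs_le_iff field_simps)
qed

lemma half_twist_disk:
  assumes "i \<in> {1..<n}" "z \<in> disk n"
  shows "half_twist e i z \<in> disk n"
proof (cases "1 \<le> norm (z - of_real (real i + 1 / 2))")
  case True
  then show ?thesis using assms by (simp only: half_twist_far)
next
  case False
  then have "dist (of_real (real i + 1 / 2)) (half_twist e i z) < 1"
    by (simp only: dist_norm norm_minus_commute[of "of_real (real i + 1 / 2)"] norm_half_twist)
  with norm_disk_centre[OF assms(1)] show ?thesis
    unfolding disk_def mem_cball
    using dist_triangle[of "of_real ((real n + 1) / 2)" "half_twist e i z" "of_real (real i + 1 / 2)"]
    by linarith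
qed

lemma half_twist_frontier:
  assumes "i \<in> {1..<n}" "z \<in> frontier (disk n)"
  shows "half_twist e i z = z"
proof (rule half_twist_far)
  have "dist (of_real ((real n + 1) / 2)) z = (real n + 1) / 2"
    using assms(2) by (simp add: disk_def frontier_cball del: of_real_divide of_real_add)
  then show "1 \<le> norm (z - of_real (real i + 1 / 2))"
    using norm_disk_centre[OF assms(1)]
      dist_triangle[of "of_real ((real n + 1) / 2)" z "of_real (real i + 1 / 2)"]
    unfolding dist_norm[symmetric] dist_commute[of z] by linarith
qed

lemma half_twist_puncture:
  assumes "e = 1 \<or> e = - 1"
  shows "half_twist e i (of_nat j) = of_nat (if j = i then Suc i else if j = Suc i then i else j)"
proof -
  have d: "norm (of_nat j - of_real (real i + 1 / 2) :: complex) = \<bar>real j - (real i + 1 / 2)\<bar>"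
    by (metis of_real_of_nat_eq of_real_diff norm_of_real)
  have e: "cis (pi * e) = - 1"
    using assms by (auto simp: complex_eq_iff)
  consider "j = i" | "j = Suc i" | "j \<noteq> i" "j \<noteq> Suc i" by blast
  then show ?thesis
  proof cases
    case 3
    then have "1 \<le> \<bar>real j - (real i + 1 / 2)\<bar>" by (cases "j < i") auto
    then show ?thesis using half_twist_far[of "of_nat j" i e] 3 d by simp
  qed (unfold half_twist_def Let_def d, simp_all add: e field_simps)
qed

lemma half_twist_homeo:
  assumes "i \<in> {1..<n}" "e = 1 \<or> e = - 1"
  shows "punctured_disk_homeo n (half_twist e i)"
proof -
  have "homeomorphism (disk n) (disk n) (half_twist e i) (half_twist (- e) i)"
    using half_twist_inverse[of "- e"]
    by (intro homeomorphismI)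
      (auto simp: continuous_half_twist half_twist_inverse half_twist_disk[OF assms(1)])
  moreover have "half_twist e i ` punctures n = punctures n"
  proof -
    have "f ` {1..n} = {1..n}" if "f = (\<lambda>j. if j = i then Suc i else if j = Suc i then i else j)" for f
    proof
      show "f ` {1..n} \<subseteq> {1..n}" using assms(1) that by auto
      show "{1..n} \<subseteq> f ` {1..n}"
      proof
        fix j assume "j \<in> {1..n}"
        then have "f j \<in> {1..n}" "f (f j) = j" using assms(1) that by auto
        then show "j \<in> f ` {1..n}" by (metis imageI)
      qed
    qed
    then show ?thesis
      unfolding punctures_def image_image half_twist_puncture[OF assms(2)]
      by (metis (no_types, lifting) image_cong image_image)
  qed
  ultimately show ?thesis
    unfolding punctured_disk_homeo_def using half_twist_frontier[OF assms(1)] by blast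
qed

lemma punctured_disk_homeo_comp:
  assumes "punctured_disk_homeo n f" "punctured_disk_homeo n g"
  shows "punctured_disk_homeo n (g \<circ> f)"
proof -
  have "(g \<circ> f) ` punctures n = punctures n"
    using assms unfolding punctured_disk_homeo_def by (metis image_comp)
  then show ?thesis
    using assms homeomorphism_compose unfolding punctured_disk_homeo_def by fastforce
qed

lemma braid_homeo_homeo:
  assumes "w \<in> lists (letters n)"
  shows "punctured_disk_homeo n (braid_homeo w)"
  using assms
proof (induction w)
  case Nil
  then show ?case
    unfolding punctured_disk_homeo_def by (auto intro: homeomorphism_ident simp: id_def)
next
  case (Cons x w)
  then have "punctured_disk_homeo n (letter_homeo x)"
    by (auto simp: letters_def half_twist_homeo)
  moreover have "punctured_disk_homeo n (braid_homeo w)" using Cons by simp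
  ultimately show ?case
    unfolding braid_homeo.simps by (rule punctured_disk_homeo_comp)
qed

definition mapping_class :: "nat \<Rightarrow> letter list set \<Rightarrow> (complex \<Rightarrow> complex) set" where
  "mapping_class n b = {h. \<exists>w\<in>b.
     homotopic_with_canon (punctured_disk_homeo n) (disk n) (disk n) (braid_homeo w) h}"

section \<open>Reducibility\<close>

definition simple_loop :: "(real \<Rightarrow> complex) \<Rightarrow> bool" where
  "simple_loop g \<longleftrightarrow> simple_path g \<and> pathfinish g = pathstart g"

text \<open>Curves are unoriented and unparametrised, i.e. subsets of the punctured disk. Isotopic
  means homotopic through simple closed curves.\<close>

definition essential_curve :: "nat \<Rightarrow> complex set \<Rightarrow> bool" where
  "essential_curve n C \<longleftrightarrow> (\<exists>g. simple_loop g \<and> path_image g = C) \<and> C \<subseteq> disk n - punctures n \<and>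
     2 \<le> card (inside C \<inter> punctures n) \<and> card (inside C \<inter> punctures n) \<le> n - 1"

definition isotopic_curves :: "nat \<Rightarrow> complex set \<Rightarrow> complex set \<Rightarrow> bool" where
  "isotopic_curves n C C' \<longleftrightarrow> (\<exists>g g'. path_image g = C \<and> path_image g' = C' \<and>
     homotopic_with_canon simple_loop {0..1} (disk n - punctures n) g g')"

text \<open>The last two conditions say that \<open>h\<close> maps the set of isotopy classes of the curves in \<open>F\<close>
  onto itself.\<close>

definition reducible_braid :: "nat \<Rightarrow> letter list set \<Rightarrow> bool" where
  "reducible_braid n b \<longleftrightarrow> (\<exists>h\<in>mapping_class n b. \<exists>F. F \<noteq> {} \<and>
     (\<forall>C\<in>F. essential_curve n C) \<and> pairwise disjnt F \<and>
     (\<forall>C\<in>F. \<exists>C'\<in>F. isotopic_curves n (h ` C) C') \<and>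
     (\<forall>C'\<in>F. \<exists>C\<in>F. isotopic_curves n (h ` C) C'))"

end

theory Submission imports Defs "HOL-Complex_Analysis.Winding_Numbers"
begin

text \<open>Let \<open>C\<close> be a curve of the reducing family and \<open>S\<close> the set of the strands that start inside
  \<open>C\<close>. For a pure braid \<open>a\<^sub>k\<^sub>l\<close> is, up to a sign that depends only on conventions, the linking number
  of the strands \<open>k\<close> and \<open>l\<close>: the number of full turns of the vector from \<open>k\<close> to \<open>l\<close> while the braid
  runs. For \<open>k\<close> outside \<open>C\<close>, all \<open>a\<^sub>k\<^sub>l\<close> with \<open>l \<in> S\<close> agree.

  Join two punctures \<open>l\<close> and \<open>l'\<close> of \<open>S\<close> by a path \<open>p\<close> inside \<open>C\<close>, let \<open>f\<close> be the homeomorphism of the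
  braid and let \<open>f\<^sub>t\<close> be the isotopy from the identity to \<open>f\<close> that rotates the half twists in. The map
  \<open>(t, u) \<mapsto> f\<^sub>t (p u) - f\<^sub>t k\<close> has no zeros on the unit square, so the angle swept along its boundary
  vanishes. Two sides contribute the linking numbers of \<open>k\<close> with \<open>l\<close> and \<open>l'\<close>, the other two the angles
  that \<open>p\<close> and \<open>f \<circ> p\<close> sweep around \<open>k\<close>. Hence \<open>a\<^sub>k\<^sub>l\<close> and \<open>a\<^sub>k\<^sub>l\<^sub>'\<close> agree as soon as \<open>p\<close> and \<open>f \<circ> p\<close>
  sweep the same angle (\<open>winding_number_braid\<close>, by induction on the letters of a word).

  The angle swept around \<open>k\<close> is the same for all paths from \<open>l\<close> to \<open>l'\<close> inside a Jordan curve that has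
  \<open>k\<close> outside (\<open>winding_number_turning\<close>), so it belongs to the curve. It does not change under an
  isotopy of the curve that avoids the punctures, because a path inside the curve remains inside for
  a short time (\<open>turning_simple_loop_family\<close>). Disjoint curves that both enclose \<open>l\<close> have nested
  insides, so they have the same angle as well (\<open>turning_disjoint\<close>). The path \<open>p\<close> lies inside \<open>C\<close> and
  \<open>f \<circ> p\<close> inside \<open>f ` C\<close>, and \<open>f ` C\<close> is isotopic to \<open>h ` C\<close> and then to a curve \<open>C'\<close> of the family
  that is equal to \<open>C\<close> or disjoint from it. So the two angles agree.\<close>

section \<open>The inside of a Jordan curve\<close>

definition jordan_curve :: "complex set \<Rightarrow> bool" where
  "jordan_curve C \<longleftrightarrow> (\<exists>g. simple_loop g \<and> path_image g = C)"

lemma jordan_curve_facts: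
  assumes "jordan_curve C"
  shows "compact C" "connected C" "open (inside C)" "connected (inside C)" "bounded (inside C)"
proof -
  obtain g where g: "simple_path g" "pathfinish g = pathstart g" and C: "path_image g = C"
    using assms by (auto simp: jordan_curve_def simple_loop_def)
  show "compact C" "connected C"
    using g C by (auto simp: compact_simple_path_image connected_simple_path_image)
  show "open (inside C)" "connected (inside C)" "bounded (inside C)"
    using Jordan_inside_outside[OF g] C by auto
qed

lemma connected_subset_inside:
  assumes "connected K" "K \<inter> C = {}" "z \<in> K" "z \<in> inside C"
  shows "K \<subseteq> inside C"
proof
  fix y assume "y \<in> K"
  have "K \<subseteq> connected_component_set (- C) z"
    using assms by (intro connected_component_maximal) auto
  then show "y \<in> inside C"
    using \<open>y \<in> K\<close> assms(4) inside_same_component by blast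
qed

text \<open>If \<open>C'\<close> does not meet the inside of \<open>C\<close>, that inside is a connected set off \<open>C'\<close> and, because of
  \<open>z\<close>, inside \<open>C'\<close>. Otherwise the connected set \<open>C'\<close> lies inside \<open>C\<close>, and its own inside follows.\<close>

lemma jordan_curves_nested:
  assumes "jordan_curve C" "jordan_curve C'" "C \<inter> C' = {}" "z \<in> inside C" "z \<in> inside C'"
  shows "inside C \<subseteq> inside C' \<or> inside C' \<subseteq> inside C"
proof (cases "inside C \<inter> C' = {}")
  case True
  then show ?thesis
    using connected_subset_inside[of "inside C" C'] assms jordan_curve_facts(4) by blast
next
  case False
  then have "C' \<subseteq> inside C"
    using connected_subset_inside[of C' C] assms jordan_curve_facts(2)[of C'] by blast
  then show ?thesis
    using inside_inside_compact_connected[of C' C] jordan_curve_facts(1,2) assms(1,2)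
      compact_imp_closed by blast
qed

lemma jordan_curve_homeomorphic_image:
  fixes f g :: "complex \<Rightarrow> complex"
  assumes f: "homeomorphism UNIV UNIV f g" and C: "jordan_curve C"
  shows "jordan_curve (f ` C)"
proof -
  obtain c where c: "simple_path c" "pathfinish c = pathstart c" "path_image c = C"
    using C by (auto simp: jordan_curve_def simple_loop_def)
  have "continuous_on A f" "inj_on f A" for A
    using f by (auto simp: homeomorphism_def intro: continuous_on_subset inj_on_inverseI)
  then have "simple_path (f \<circ> c)"
    using c by (intro simple_path_continuous_image) auto
  then show ?thesis
    unfolding jordan_curve_def simple_loop_def using c
    by (intro exI[of _ "f \<circ> c"]) (auto simp: path_image_compose pathfinish_compose pathstart_compose)
qed

text \<open>A point is inside a set if its component in the complement is bounded. The component of \<open>f z\<close> in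
  the complement of \<open>f ` C\<close> is carried by \<open>g\<close> into the inside of \<open>C\<close>, whose closure is compact, and
  so it is bounded.\<close>

lemma homeomorphic_image_inside_subset:
  fixes f g :: "complex \<Rightarrow> complex"
  assumes f: "homeomorphism UNIV UNIV f g" and C: "jordan_curve C"
  shows "f ` inside C \<subseteq> inside (f ` C)"
proof
  have cont: "continuous_on A f" "continuous_on B g" for A B
    using f by (auto simp: homeomorphism_def intro: continuous_on_subset)
  have inv: "g (f z) = z" "f (g z) = z" for z
    using f by (auto simp: homeomorphism_def)
  fix w assume "w \<in> f ` inside C"
  then obtain z where z: "z \<in> inside C" "w = f z" by auto
  define K where "K = connected_component_set (- f ` C) w"
  have "w \<notin> f ` C"
    using z inv inside_no_overlap by (metis disjoint_iff imageE)
  then have "w \<in> K" unfolding K_def by simp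
  have "g ` K \<subseteq> inside C"
  proof (rule connected_subset_inside)
    show "connected (g ` K)"
      unfolding K_def using cont by (intro connected_continuous_image) auto
    show "g ` K \<inter> C = {}"
    proof -
      have "y \<notin> C" if "f y \<in> K" for y
        using that connected_component_subset[of "- f ` C" w] by (auto simp: K_def)
      then have "g y \<notin> C" if "y \<in> K" for y using that inv(2) by simp
      then show ?thesis by blast
    qed
    show "z \<in> g ` K" using \<open>w \<in> K\<close> z inv by (metis imageI)
  qed (use z in auto)
  then have "f ` g ` K \<subseteq> f ` closure (inside C)"
    using closure_subset by blast
  then have "K \<subseteq> f ` closure (inside C)"
    by (simp add: image_image inv)
  moreover have "bounded (f ` closure (inside C))"
    using jordan_curve_facts(5)[OF C] cont(1)
    by (intro compact_imp_bounded compact_continuous_image) (auto simp: compact_closure)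
  ultimately have "bounded K" using bounded_subset by blast
  then show "w \<in> inside (f ` C)"
    using \<open>w \<notin> f ` C\<close> by (simp add: inside_def K_def)
qed

lemma homeomorphic_image_inside:
  fixes f g :: "complex \<Rightarrow> complex"
  assumes f: "homeomorphism UNIV UNIV f g" and C: "jordan_curve C"
  shows "inside (f ` C) = f ` inside C"
proof -
  have g: "homeomorphism UNIV UNIV g f"
    using f homeomorphism_symD by blast
  have inv: "g (f z) = z" "f (g z) = z" for z
    using f by (auto simp: homeomorphism_def)
  have "g ` inside (f ` C) \<subseteq> inside (g ` f ` C)"
    using homeomorphic_image_inside_subset[OF g] jordan_curve_homeomorphic_image[OF f C] by blast
  then have "f ` g ` inside (f ` C) \<subseteq> f ` inside (g ` f ` C)" by blast
  then have "inside (f ` C) \<subseteq> f ` inside C"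
    by (simp add: image_image inv)
  then show ?thesis
    using homeomorphic_image_inside_subset[OF f C] by blast
qed

text \<open>This makes being inside a homotopy invariant: winding numbers do not change under homotopies that
  avoid the point.\<close>

lemma inside_iff_winding_number:
  assumes "simple_loop g" "z \<notin> path_image g"
  shows "z \<in> inside (path_image g) \<longleftrightarrow> winding_number g z \<noteq> 0"
proof
  have g: "simple_path g" "pathfinish g = pathstart g"
    using assms(1) by (auto simp: simple_loop_def)
  show "winding_number g z \<noteq> 0" if "z \<in> inside (path_image g)"
    using simple_closed_path_norm_winding_number_inside[OF g(1) that] by auto
  show "z \<in> inside (path_image g)" if "winding_number g z \<noteq> 0"
    using that assms(2) winding_number_zero_in_outside[OF simple_path_imp_path[OF g(1)] g(2), of z]
    by (auto simp: inside_outside)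
qed

text \<open>The first argument of \<open>G\<close> is time; \<open>X\<close> is the region to which the moving curve is confined.\<close>

definition simple_loop_family :: "complex set \<Rightarrow> (real \<times> real \<Rightarrow> complex) \<Rightarrow> bool" where
  "simple_loop_family X G \<longleftrightarrow> continuous_on ({0..1} \<times> {0..1}) G \<and> G ` ({0..1} \<times> {0..1}) \<subseteq> X \<and>
     (\<forall>t\<in>{0..1}. simple_loop (\<lambda>s. G (t, s)))"

lemma homotopic_simple_loops_family:
  assumes "homotopic_with_canon simple_loop {0..1} X g g'"
  obtains G where "simple_loop_family X G" "(\<lambda>s. G (0, s)) = g" "(\<lambda>s. G (1, s)) = g'"
  using assms unfolding homotopic_with_def simple_loop_family_def
  by (auto simp: fun_eq_iff)

text \<open>The curve at time \<open>t\<close> is homotopic to the initial one within \<open>X\<close>, so both wind equally often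
  around a point off \<open>X\<close>.\<close>

lemma simple_loop_family_inside:
  assumes G: "simple_loop_family X G" and "z \<notin> X" "t \<in> {0..1}"
  shows "z \<in> inside (path_image (\<lambda>s. G (0, s))) \<longleftrightarrow> z \<in> inside (path_image (\<lambda>s. G (t, s)))"
proof -
  have cont: "continuous_on ({0..1} \<times> {0..1}) G" and X: "G (r, s) \<in> X"
    and loop: "simple_loop (\<lambda>s. G (r, s))" if "r \<in> {0..1}" "s \<in> {0..1}" for r s
    using G that by (auto simp: simple_loop_family_def)
  have tr: "t * r \<in> {0..1}" if "r \<in> {0..1}" for r
    using assms(3) that by (auto simp: mult_le_one)
  have "homotopic_loops (- {z}) (\<lambda>s. G (0, s)) (\<lambda>s. G (t, s))"
    unfolding homotopic_loops
  proof (intro exI[of _ "\<lambda>(r, s). G (t * r, s)"] conjI)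
    show "continuous_on ({0..1} \<times> {0..1}) (\<lambda>(r, s). G (t * r, s))"
      unfolding case_prod_unfold using tr
      by (intro continuous_on_compose2[OF cont[of 0 0]] continuous_intros) auto
    show "(\<lambda>(r, s). G (t * r, s)) \<in> {0..1} \<times> {0..1} \<rightarrow> - {z}"
      using X tr assms(2) by fastforce
    show "\<forall>r\<in>{0..1}. pathfinish ((\<lambda>(r, s). G (t * r, s)) \<circ> Pair r) =
        pathstart ((\<lambda>(r, s). G (t * r, s)) \<circ> Pair r)"
      using loop[OF tr, of _ 0] by (auto simp: simple_loop_def pathfinish_def pathstart_def)
  qed auto
  then have "winding_number (\<lambda>s. G (0, s)) z = winding_number (\<lambda>s. G (t, s)) z"
    by (rule winding_number_homotopic_loops)
  moreover have "z \<notin> path_image (\<lambda>s. G (r, s))" if "r \<in> {0..1}" for r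
    using X[OF that] assms(2) by (auto simp: path_image_def)
  ultimately show ?thesis
    using inside_iff_winding_number[OF loop[of _ 0], of 0 z] inside_iff_winding_number[OF loop[of _ 0], of t z]
      assms(3) by auto
qed

section \<open>Turning angles\<close>

text \<open>In turns, the real part is the angle through which \<open>q\<close> sees a point move from \<open>x\<close> to \<open>y\<close> inside
  \<open>C\<close>. The choice of the path is immaterial by the next lemma.\<close>

definition turning :: "complex set \<Rightarrow> complex \<Rightarrow> complex \<Rightarrow> complex \<Rightarrow> complex" where
  "turning C q x y = winding_number
     (SOME p. path p \<and> path_image p \<subseteq> inside C \<and> pathstart p = x \<and> pathfinish p = y) q"

text \<open>Two paths inside \<open>C\<close> with common ends form a loop inside \<open>C\<close>, and \<open>q\<close> is outside that loop.\<close>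

lemma winding_number_turning:
  assumes "path p" "path_image p \<subseteq> inside C" "q \<in> outside C"
  shows "winding_number p q = turning C q (pathstart p) (pathfinish p)"
proof -
  define r where "r = (SOME r. path r \<and> path_image r \<subseteq> inside C \<and>
    pathstart r = pathstart p \<and> pathfinish r = pathfinish p)"
  have r: "path r" "path_image r \<subseteq> inside C" "pathstart r = pathstart p" "pathfinish r = pathfinish p"
    using someI[of "\<lambda>r. path r \<and> path_image r \<subseteq> inside C \<and>
      pathstart r = pathstart p \<and> pathfinish r = pathfinish p" p] assms(1,2)
    unfolding r_def by auto
  have q: "q \<notin> inside C" using assms(3) inside_Int_outside by blast
  have "outside (C \<union> inside C) \<subseteq> outside (path_image p \<union> path_image r)"
    using assms r by (intro outside_mono) auto
  moreover have "q \<in> outside (C \<union> inside C)"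
    using assms(3) outside_Un_outside_Un[of "inside C" C "{}"] by auto
  ultimately have "q \<in> outside (path_image (p +++ reversepath r))"
    using r by (simp add: path_image_join subsetD)
  then have "winding_number (p +++ reversepath r) q = 0"
    using assms(1) r by (intro winding_number_zero_in_outside) auto
  then have "winding_number p q = winding_number r q"
    using assms r q winding_number_join[of p q "reversepath r"] winding_number_reversepath[of r q]
    by auto
  then show ?thesis by (simp add: turning_def r_def)
qed

lemma path_inside_jordan_curve:
  assumes "jordan_curve C" "x \<in> inside C" "y \<in> inside C"
  obtains p where "path p" "path_image p \<subseteq> inside C" "pathstart p = x" "pathfinish p = y"
  using assms jordan_curve_facts(3,4)[OF assms(1)] connected_open_path_connected
  unfolding path_connected_def by blast

lemma turning_nested:
  assumes "jordan_curve C" "inside C \<subseteq> inside C'" "q \<in> outside C" "q \<in> outside C'"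
    and "x \<in> inside C" "y \<in> inside C"
  shows "turning C q x y = turning C' q x y"
proof -
  obtain p where p: "path p" "path_image p \<subseteq> inside C" "pathstart p = x" "pathfinish p = y"
    using path_inside_jordan_curve[OF assms(1,5,6)] .
  then show ?thesis
    using winding_number_turning[of p C q] winding_number_turning[of p C' q] assms(2-4) by auto
qed

lemma turning_disjoint:
  assumes "jordan_curve C" "jordan_curve C'" "C = C' \<or> C \<inter> C' = {}"
    and "q \<in> outside C" "q \<in> outside C'"
    and "x \<in> inside C" "y \<in> inside C" "x \<in> inside C'" "y \<in> inside C'"
  shows "turning C q x y = turning C' q x y"
  using assms jordan_curves_nested[of C C' x] turning_nested[of C C' q x y] turning_nested[of C' C q x y]
  by metis

text \<open>The value is locally constant in time: a path inside the curve at time \<open>a\<close> is a compact set off the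
  curve, so for times close to \<open>a\<close> the curve still avoids it, and the path is still inside because its
  starting point is. Hence one path computes the value at all times close to \<open>a\<close>.\<close>

lemma turning_simple_loop_family:
  assumes G: "simple_loop_family X G" and X: "q \<notin> X" "x \<notin> X" "y \<notin> X"
    and in0: "q \<notin> inside (path_image (\<lambda>s. G (0, s)))"
      "x \<in> inside (path_image (\<lambda>s. G (0, s)))" "y \<in> inside (path_image (\<lambda>s. G (0, s)))"
  shows "turning (path_image (\<lambda>s. G (0, s))) q x y = turning (path_image (\<lambda>s. G (1, s))) q x y"
proof -
  define C where "C t = path_image (\<lambda>s. G (t, s))" for t
  have CX: "C t \<subseteq> X" and jordan: "jordan_curve (C t)" if "t \<in> {0..1}" for t
  proof -
    show "C t \<subseteq> X"
      using G that by (auto simp: simple_loop_family_def C_def path_image_def image_subset_iff)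
    show "jordan_curve (C t)"
      using G that unfolding simple_loop_family_def jordan_curve_def C_def by blast
  qed
  have inside: "x \<in> inside (C t)" "y \<in> inside (C t)" and outside: "q \<in> outside (C t)"
    if "t \<in> {0..1}" for t
    using simple_loop_family_inside[OF G _ that] in0 X CX[OF that] by (auto simp: C_def outside_inside)
  have "turning (C 0) q x y = turning (C 1) q x y"
  proof (rule connected_local_const[of "{0..1}" 0 1 "\<lambda>t. turning (C t) q x y"], safe)
    fix a :: real assume a: "a \<in> {0..1}"
    obtain p where p: "path p" "path_image p \<subseteq> inside (C a)" "pathstart p = x" "pathfinish p = y"
      using path_inside_jordan_curve[OF jordan[OF a] inside[OF a]] .
    \<comment> \<open>The times at which the moving curve meets the path form a closed set.\<close>
    define M where "M = fst ` (({0..1} \<times> {0..1}) \<inter> G -` path_image p)"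
    have "compact (({0..1} \<times> {0..1}) \<inter> G -` path_image p)"
    proof -
      have "closed (({0..1} \<times> {0..1}) \<inter> G -` path_image p)"
        using G closed_path_image[OF p(1)]
        by (intro continuous_closed_preimage) (auto simp: simple_loop_family_def closed_Times)
      then show ?thesis
        using compact_Int_closed[of "{0..1::real} \<times> {0..1::real}"]
        by (metis Int_left_absorb compact_Icc compact_Times)
    qed
    then have "closed M"
      unfolding M_def by (intro compact_imp_closed compact_continuous_image continuous_intros)
    have M: "C t \<inter> path_image p = {} \<longleftrightarrow> t \<notin> M" if "t \<in> {0..1}" for t
      using that by (force simp: C_def M_def path_image_def[of "\<lambda>s. G (t, s)"])
    have turn: "turning (C t) q x y = winding_number p q" if "t \<in> {0..1}" "t \<notin> M" for t
    proof -
      have "path_image p \<subseteq> inside (C t)"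
        using connected_subset_inside[of "path_image p" "C t" x] connected_path_image[OF p(1)]
          M[OF that(1)] that(2) inside(1)[OF that(1)] pathstart_in_path_image[of p] p(3) by auto
      then show ?thesis
        using winding_number_turning[OF p(1)] outside[OF that(1)] p(3,4) by simp
    qed
    have "a \<notin> M"
      using M[OF a] p(2) inside_no_overlap[of "C a"] by blast
    then show "\<forall>\<^sub>F b in at a within {0..1}. turning (C a) q x y = turning (C b) q x y"
      using \<open>closed M\<close> turn a unfolding eventually_at_topological
      by (intro exI[of _ "- M"]) auto
  qed auto
  then show ?thesis by (simp add: C_def)
qed

lemma isotopic_curves_inside:
  assumes "isotopic_curves n C C'" "z \<in> punctures n"
  shows "z \<in> inside C \<longleftrightarrow> z \<in> inside C'"
  using assms simple_loop_family_inside[of "disk n - punctures n" _ z 1]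
  unfolding isotopic_curves_def by (auto elim!: homotopic_simple_loops_family)

lemma isotopic_curves_turning:
  assumes "isotopic_curves n C C'" "q \<in> punctures n" "x \<in> punctures n" "y \<in> punctures n"
    and "q \<notin> inside C" "x \<in> inside C" "y \<in> inside C"
  shows "turning C q x y = turning C' q x y"
  using assms turning_simple_loop_family[of "disk n - punctures n" _ q x y]
  unfolding isotopic_curves_def by (auto elim!: homotopic_simple_loops_family)

text \<open>Each homeomorphism of the isotopy preserves the set of punctures, so it maps \<open>C\<close> to a Jordan curve
  that again avoids them. This replaces the homeomorphism \<open>h\<close> of the mapping class, which is
  controlled only on the disk, by the explicit product of half twists, whose isotopy to the identity is known.\<close>

lemma isotopic_homeo_image_curves:
  assumes fh: "homotopic_with_canon (punctured_disk_homeo n) (disk n) (disk n) f h"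
    and C: "jordan_curve C" "C \<subseteq> disk n - punctures n"
  shows "isotopic_curves n (f ` C) (h ` C)"
proof -
  obtain g where g: "simple_loop g" "path_image g = C"
    using C(1) by (auto simp: jordan_curve_def)
  obtain K :: "real \<times> complex \<Rightarrow> complex" where K: "continuous_on ({0..1} \<times> disk n) K" "K ` ({0..1} \<times> disk n) \<subseteq> disk n"
      "\<And>z. K (0, z) = f z" "\<And>z. K (1, z) = h z"
      "\<And>t. t \<in> {0..1} \<Longrightarrow> punctured_disk_homeo n (\<lambda>z. K (t, z))"
    using fh unfolding homotopic_with_def
    by (auto simp: image_subset_iff_funcset)
  have gs: "g s \<in> disk n" "g s \<notin> punctures n" if "s \<in> {0..1}" for s
    using C(2) that unfolding g(2)[symmetric] path_image_def by blast+
  have cg: "continuous_on {0..1} g"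
    using g(1) by (auto simp: simple_loop_def simple_path_def path_def)
  have "punctures n \<subseteq> disk n"
  proof
    fix z assume "z \<in> punctures n"
    then obtain j where j: "z = of_nat j" "1 \<le> j" "j \<le> n" by (auto simp: punctures_def)
    then have "dist (of_real ((real n + 1) / 2)) (of_real (real j) :: complex) \<le> (real n + 1) / 2"
      by (simp only: dist_of_real dist_real_def) (simp add: abs_le_iff field_simps)
    then show "z \<in> disk n" using j by (simp add: disk_def)
  qed
  have inj: "inj_on (\<lambda>z. K (t, z)) (disk n)" and cK: "continuous_on (disk n) (\<lambda>z. K (t, z))"
    and pK: "(\<lambda>z. K (t, z)) ` punctures n = punctures n" if "t \<in> {0..1}" for t
    using K(5)[OF that] by (auto simp: punctured_disk_homeo_def homeomorphism_def intro: inj_on_inverseI)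
  have avoid: "K (t, g s) \<in> disk n - punctures n" if ts: "t \<in> {0..1}" "s \<in> {0..1}" for t s
  proof -
    have "K (t, g s) \<notin> punctures n"
    proof
      assume "K (t, g s) \<in> punctures n"
      then obtain z where "z \<in> punctures n" "K (t, g s) = K (t, z)" using pK[OF ts(1)] by auto
      then show False
        using inj_onD[OF inj[OF ts(1)], of "g s" z] gs[OF ts(2)] \<open>punctures n \<subseteq> disk n\<close> by auto
    qed
    then show ?thesis using K(2) ts gs by auto
  qed
  have loop: "simple_loop (\<lambda>s. K (t, g s))" if "t \<in> {0..1}" for t
  proof -
    have "simple_path ((\<lambda>z. K (t, z)) \<circ> g)"
      using g C(2) inj[OF that] cK[OF that]
      by (intro simple_path_continuous_image)
        (auto simp: simple_loop_def intro: continuous_on_subset inj_on_subset)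
    then show ?thesis
      using g(1) by (simp add: simple_loop_def pathfinish_def pathstart_def o_def)
  qed
  have cont: "continuous_on ({0..1} \<times> {0..1}) (\<lambda>z. K (fst z, g (snd z)))"
    using gs by (intro continuous_on_compose2[OF K(1)] continuous_on_Pair continuous_intros
        continuous_on_compose2[OF cg]) auto
  have "homotopic_with_canon simple_loop {0..1} (disk n - punctures n) (f \<circ> g) (h \<circ> g)"
    unfolding homotopic_with_def
    using cont avoid loop K(3,4)
    by (intro exI[of _ "\<lambda>z. K (fst z, g (snd z))"]) auto
  then show ?thesis
    unfolding isotopic_curves_def using g(2)
    by (intro exI[of _ "f \<circ> g"] exI[of _ "h \<circ> g"]) (simp add: path_image_compose)
qed

section \<open>Winding numbers under half twists\<close>

fun generator :: "letter \<Rightarrow> nat" where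
  "generator (Sig i) = i"
| "generator (SigInv i) = i"

fun half_turns :: "letter \<Rightarrow> real" where
  "half_turns (Sig i) = - 1"
| "half_turns (SigInv i) = 1"

definition swap_adjacent :: "nat \<Rightarrow> nat \<Rightarrow> nat" where
  "swap_adjacent i j = (if j = i then Suc i else if j = Suc i then i else j)"

fun final_position :: "letter list \<Rightarrow> nat \<Rightarrow> nat" where
  "final_position [] j = j"
| "final_position (x # w) j = final_position w (swap_adjacent (generator x) j)"

lemma letter_homeo_half_twist: "letter_homeo x = half_twist (half_turns x) (generator x)"
  by (cases x) auto

lemma half_turns_cases: "half_turns x = 1 \<or> half_turns x = - 1"
  by (cases x) auto

lemma continuous_on_half_twist:
  assumes "continuous_on A a" "continuous_on A f"
  shows "continuous_on A (\<lambda>x. half_twist (a x) i (f x))"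
  unfolding half_twist_def Let_def cis_conv_exp by (intro continuous_intros assms)

lemma half_twist_eq_iff: "half_twist e i z = half_twist e i z' \<longleftrightarrow> z = z'"
  by (metis half_twist_inverse)

lemma letter_homeo_puncture: "letter_homeo x (of_nat j) = of_nat (swap_adjacent (generator x) j)"
  using half_twist_puncture[OF half_turns_cases] by (simp add: letter_homeo_half_twist swap_adjacent_def)

lemma homeomorphism_braid_homeo: "\<exists>g. homeomorphism UNIV UNIV (braid_homeo w) g"
proof (induction w)
  case Nil
  then show ?case using homeomorphism_ident by (auto simp: id_def)
next
  case (Cons x w)
  have "homeomorphism UNIV UNIV (letter_homeo x) (half_twist (- half_turns x) (generator x))"
    using half_twist_inverse[of "- half_turns x"]
    by (intro homeomorphismI) (auto simp: letter_homeo_half_twist continuous_half_twist half_twist_inverse)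
  then show ?case
    using Cons homeomorphism_compose unfolding braid_homeo.simps by blast
qed

lemma braid_homeo_puncture: "braid_homeo w (of_nat j) = of_nat (final_position w j)"
  by (induction w arbitrary: j) (auto simp: letter_homeo_puncture)

lemma arrangement_Cons: "arrangement s (x # w) = arrangement (exchange (generator x) s) w"
  by (cases x) auto

lemma exchange_swap_adjacent: "exchange i s (swap_adjacent i j) = s j"
  by (auto simp: exchange_def swap_adjacent_def)

lemma arrangement_final_position: "arrangement s w (final_position w j) = s j"
  by (induction w arbitrary: s j) (auto simp: arrangement_Cons exchange_swap_adjacent)

lemma winding_number_exp_lift:
  assumes "path l" "\<And>t. 0 \<le> t \<Longrightarrow> t \<le> 1 \<Longrightarrow> p t = exp (l t)"
  shows "Re (winding_number p 0) = Im (l 1 - l 0) / (2 * pi)"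
proof -
  have "winding_number p 0 = winding_number (exp \<circ> l) 0"
    using assms(2) by (intro winding_number_cong) auto
  also have "\<dots> = (l 1 - l 0) / (2 * of_real pi * \<i>)"
    using winding_number_compose_exp[OF assms(1)] by (simp add: pathstart_def pathfinish_def)
  also have "(l 1 - l 0) / (2 * of_real pi * \<i>) = of_real (1 / (2 * pi)) * (- \<i> * (l 1 - l 0))"
    by (simp add: field_simps)
  finally show ?thesis
    by (simp only: Re_complex_of_real Re_divide_of_real times_complex.simps) simp
qed

text \<open>By contractibility of the square, \<open>\<phi>\<close> has a continuous logarithm \<open>l\<close>, and both sides are the
  imaginary part of \<open>l (1, 1) - l (1, 0) - l (0, 1) + l (0, 0)\<close>, in turns.\<close>

lemma winding_number_square:
  assumes cont: "continuous_on ({0..1} \<times> {0..1}) \<phi>" and nz: "\<And>z. z \<in> {0..1} \<times> {0..1} \<Longrightarrow> \<phi> z \<noteq> 0"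
  shows "Re (winding_number (\<lambda>u. \<phi> (1, u)) 0) - Re (winding_number (\<lambda>u. \<phi> (0, u)) 0) =
    Re (winding_number (\<lambda>t. \<phi> (t, 1)) 0) - Re (winding_number (\<lambda>t. \<phi> (t, 0)) 0)"
proof -
  have "contractible ({0..1::real} \<times> {0..1::real})"
    by (intro convex_imp_contractible convex_Times) auto
  then obtain l where l: "continuous_on ({0..1} \<times> {0..1}) l"
      and exp: "\<And>z. z \<in> {0..1} \<times> {0..1} \<Longrightarrow> \<phi> z = exp (l z)"
    using continuous_logarithm_on_contractible[OF cont _ nz] by blast
  have path: "path (\<lambda>u. l (a, u))" "path (\<lambda>t. l (t, a))" if "a \<in> {0..1}" for a
    unfolding path_def using that
    by (auto intro!: continuous_on_compose2[OF l] continuous_intros)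
  have v: "Re (winding_number (\<lambda>u. \<phi> (a, u)) 0) = Im (l (a, 1) - l (a, 0)) / (2 * pi)"
    if "a \<in> {0..1}" for a
    using winding_number_exp_lift[OF path(1)[OF that]] that exp by auto
  have h: "Re (winding_number (\<lambda>t. \<phi> (t, a)) 0) = Im (l (1, a) - l (0, a)) / (2 * pi)"
    if "a \<in> {0..1}" for a
    using winding_number_exp_lift[OF path(2)[OF that]] that exp by auto
  show ?thesis
    using v[of 0] v[of 1] h[of 0] h[of 1] by (simp add: diff_divide_distrib)
qed

text \<open>The path stays in a half plane to the left or the right of the imaginary axis, and it starts and
  ends on the real axis, hence on the same ray. The constant \<open>c\<close> selects the half plane.\<close>

lemma winding_number_same_side:
  assumes "path p" "\<And>t. t \<in> {0..1} \<Longrightarrow> 0 < c * Re (p t)" "Im (p 0) = 0" "Im (p 1) = 0"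
  shows "Re (winding_number p 0) = 0"
proof -
  define l where "l t = Ln (of_real c * p t) - Ln (of_real c)" for t
  have pos: "0 < Re (of_real c * p t)" if "t \<in> {0..1}" for t using assms(2)[OF that] by simp
  have "c \<noteq> 0" using assms(2)[of 0] by auto
  have nz: "of_real c * p t \<noteq> 0" if "t \<in> {0..1}" for t using pos[OF that] by auto
  have "of_real c * p t \<notin> \<real>\<^sub>\<le>\<^sub>0" if "t \<in> {0..1}" for t
    using pos[OF that] by (auto simp: complex_nonpos_Reals_iff)
  then have path: "path l"
    using assms(1) unfolding path_def l_def by (intro continuous_intros) auto
  have "Im (Ln (of_real c * p t)) = 0" if "t \<in> {0..1}" "Im (p t) = 0" for t
  proof -
    have "of_real c * p t = of_real (c * Re (p t))" using that(2) by (simp add: complex_eq_iff)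
    then show ?thesis using assms(2)[OF that(1)] by (metis Im_Ln_of_real)
  qed
  then have "Im (l 1 - l 0) = 0" using assms(3,4) by (simp add: l_def)
  moreover have "p t = exp (l t)" if "0 \<le> t" "t \<le> 1" for t
    using nz[of t] \<open>c \<noteq> 0\<close> that by (simp add: l_def exp_diff)
  ultimately show ?thesis
    using winding_number_exp_lift[OF path] by simp
qed

text \<open>The angle \<open>e\<close> is arbitrary here: for \<open>e\<close> running from 0 to 1 or -1 this is the trajectory of a puncture.
  The punctures \<open>i\<close> and \<open>i + 1\<close> run along the circle of radius \<open>1/2\<close>, where the angle of rotation is
  still undamped.\<close>

lemma half_twist_puncture_path:
  "half_twist e i (of_nat j) =
    (if j = i then of_real (real i + 1 / 2) - cis (e * pi) / 2
     else if j = Suc i then of_real (real i + 1 / 2) + cis (e * pi) / 2 else of_nat j)"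
proof -
  have d: "norm (of_nat j - of_real (real i + 1 / 2) :: complex) = \<bar>real j - (real i + 1 / 2)\<bar>"
    by (metis of_real_of_nat_eq of_real_diff norm_of_real)
  consider "j = i" | "j = Suc i" | "j \<noteq> i" "j \<noteq> Suc i" by blast
  then show ?thesis
  proof cases
    case 3
    then have "1 \<le> \<bar>real j - (real i + 1 / 2)\<bar>" by (cases "j < i") auto
    then show ?thesis using half_twist_far[of "of_nat j" i e] 3 d by simp
  qed (unfold half_twist_def Let_def d, simp_all add: field_simps)
qed

text \<open>The circle on which the two punctures \<open>i\<close> and \<open>i + 1\<close> travel stays in the strip between their
  abscissae, and no other puncture enters that strip.\<close>

lemma half_twist_preserves_side:
  assumes "q < y" "{q, y} \<noteq> {i, Suc i}"
  shows "Re (half_twist e i (of_nat q)) < Re (half_twist e i (of_nat y))"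
proof -
  obtain c where c: "cos (e * pi) = c" "c \<le> 1" "- 1 \<le> c"
    using cos_le_one cos_ge_minus_one by blast
  consider "y < i" | "q < i" "y \<in> {i, Suc i}" | "q < i" "Suc i < y" | "q \<in> {i, Suc i}" "Suc i < y" | "Suc i < q"
    using assms by fastforce
  then show ?thesis
    using assms(1) c(2,3) by cases (auto simp: half_twist_puncture_path c(1))
qed

text \<open>The number of half turns of the vector from the strand in position \<open>q\<close> to the strand in position
  \<open>y\<close> during one letter; it makes one only if the letter exchanges the two.\<close>

definition exchange_turns :: "letter \<Rightarrow> nat \<Rightarrow> nat \<Rightarrow> real" where
  "exchange_turns a q y = (if {q, y} = {generator a, Suc (generator a)} then half_turns a else 0)"

lemma winding_number_half_twist:
  fixes q y :: nat
  assumes "q \<noteq> y" and e: "e = 1 \<or> e = - 1"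
  shows "2 * Re (winding_number (\<lambda>t. half_twist (e * t) i (of_nat y) - half_twist (e * t) i (of_nat q)) 0) =
    (if {q, y} = {i, Suc i} then e else 0)"
proof (cases "{q, y} = {i, Suc i}")
  case True
  \<comment> \<open>The connecting vector makes half a turn.\<close>
  define \<alpha> where "\<alpha> = (if q = i then 0 else pi)"
  have "half_twist (e * t) i (of_nat y) - half_twist (e * t) i (of_nat q) = exp (\<i> * of_real (e * t * pi + \<alpha>))" for t
  proof -
    have "half_twist (e * t) i (of_nat y) - half_twist (e * t) i (of_nat q) = cis (e * t * pi + \<alpha>)"
      using True assms(1)
      by (auto simp: half_twist_puncture_path \<alpha>_def doubleton_eq_iff complex_eq_iff)
    then show ?thesis by (simp only: cis_conv_exp)
  qed
  then have "Re (winding_number (\<lambda>t. half_twist (e * t) i (of_nat y) - half_twist (e * t) i (of_nat q)) 0) =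
      Im (\<i> * of_real (e * 1 * pi + \<alpha>) - \<i> * of_real (e * 0 * pi + \<alpha>)) / (2 * pi)"
    by (intro winding_number_exp_lift) (auto simp: path_def intro!: continuous_intros)
  then show ?thesis using True by simp
next
  case False
  have "path (\<lambda>t. half_twist (e * t) i (of_nat y) - half_twist (e * t) i (of_nat q))"
    unfolding path_def by (intro continuous_on_diff continuous_on_half_twist continuous_intros)
  moreover have "0 < (real y - real q) * Re (half_twist (e * t) i (of_nat y) - half_twist (e * t) i (of_nat q))" for t
    using half_twist_preserves_side[of q y i "e * t"] half_twist_preserves_side[of y q i "e * t"] False assms(1)
    by (cases "q < y") (auto simp: insert_commute intro: mult_neg_neg)
  moreover have "Im (half_twist (e * 0) i (of_nat j)) = 0" "Im (half_twist (e * 1) i (of_nat j)) = 0" for j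
    using e by (auto simp: half_twist_puncture_path)
  ultimately show ?thesis
    using winding_number_same_side[of _ "real y - real q"] False by simp
qed

text \<open>Apply \<open>winding_number_square\<close> to the difference of the images of \<open>p u\<close> and of \<open>q\<close> under the partial
  half twist at time \<open>t\<close>. At time 0 this gives \<open>p\<close>, at time 1 its image, and the sides \<open>u = 0\<close> and
  \<open>u = 1\<close> are the vectors between moving punctures.\<close>

lemma winding_number_letter:
  assumes p: "path p" "pathstart p = of_nat x" "pathfinish p = of_nat y"
    and q: "of_nat q \<notin> path_image p"
  shows "2 * Re (winding_number (letter_homeo a \<circ> p) (letter_homeo a (of_nat q))) - 2 * Re (winding_number p (of_nat q)) =
    exchange_turns a q y - exchange_turns a q x"
proof -
  define e i where "e = half_turns a" and "i = generator a"
  define \<phi> where "\<phi> = (\<lambda>(t, u). half_twist (e * t) i (p u) - half_twist (e * t) i (of_nat q))"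
  have ends: "p 0 = of_nat x" "p 1 = of_nat y"
    using p by (auto simp: pathstart_def pathfinish_def)
  have "q \<noteq> x" "q \<noteq> y"
    using p q pathstart_in_path_image[of p] pathfinish_in_path_image[of p] by auto
  have e: "e = 1 \<or> e = - 1" using half_turns_cases by (simp add: e_def)
  have "continuous_on ({0..1} \<times> {0..1}) (\<lambda>z :: real \<times> real. p (snd z))"
    by (rule continuous_on_compose2[OF p(1)[unfolded path_def] continuous_on_snd[OF continuous_on_id]]) auto
  then have "continuous_on ({0..1} \<times> {0..1}) \<phi>"
    unfolding \<phi>_def case_prod_unfold
    by (intro continuous_on_diff continuous_on_half_twist continuous_on_mult continuous_on_const
        continuous_on_fst continuous_on_id)
  moreover have "\<phi> z \<noteq> 0" if "z \<in> {0..1} \<times> {0..1}" for z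
  proof
    assume "\<phi> z = 0"
    then have "p (snd z) = of_nat q"
      by (simp add: \<phi>_def case_prod_unfold half_twist_eq_iff)
    then show False using q that unfolding path_image_def mem_Times_iff by (metis imageI)
  qed
  ultimately have "Re (winding_number (\<lambda>u. \<phi> (1, u)) 0) - Re (winding_number (\<lambda>u. \<phi> (0, u)) 0) =
      Re (winding_number (\<lambda>t. \<phi> (t, 1)) 0) - Re (winding_number (\<lambda>t. \<phi> (t, 0)) 0)"
    by (rule winding_number_square)
  moreover have "2 * Re (winding_number (\<lambda>t. \<phi> (t, 1)) 0) = exchange_turns a q y"
      "2 * Re (winding_number (\<lambda>t. \<phi> (t, 0)) 0) = exchange_turns a q x"
    using winding_number_half_twist[OF \<open>q \<noteq> y\<close> e, of i] winding_number_half_twist[OF \<open>q \<noteq> x\<close> e, of i]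
    by (auto simp: \<phi>_def ends exchange_turns_def e_def i_def)
  moreover have "winding_number (\<lambda>u. \<phi> (1, u)) 0 = winding_number (letter_homeo a \<circ> p) (letter_homeo a (of_nat q))"
    by (subst (2) winding_number_offset) (simp add: \<phi>_def letter_homeo_half_twist e_def i_def)
  moreover have "half_twist 0 i z = z" for z
    by (simp add: half_twist_def Let_def)
  then have "winding_number (\<lambda>u. \<phi> (0, u)) 0 = winding_number p (of_nat q)"
    by (subst (2) winding_number_offset) (simp add: \<phi>_def)
  ultimately show ?thesis by simp
qed

section \<open>Crossing numbers of a word\<close>

lemma crossings_Cons:
  "crossings s (a # w) k l = crossings s [a] k l + crossings (exchange (generator a) s) w k l"
  by (cases a) auto

definition left_of :: "nat \<Rightarrow> nat \<Rightarrow> real" where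
  "left_of q y = (if q < y then 1 else 0)"

text \<open>An exchange has one crossing, while only one of its strands is the upper one; so the signed number
  of half turns does not determine how often \<open>q\<close> is over \<open>y\<close>. The correction is the change of their
  left-to-right order: exactly when the crossing is one of \<open>y\<close> over \<open>q\<close> it cancels the half turn. The
  correction telescopes over a word and vanishes for a pure braid.\<close>

lemma exchange_turns_crossings:
  assumes "inj s" "q \<noteq> y"
  shows "exchange_turns a q y = left_of (swap_adjacent (generator a) q) (swap_adjacent (generator a) y) -
    left_of q y - 2 * of_int (crossings s [a] (s q) (s y))"
proof -
  have s: "s u = s v \<longleftrightarrow> u = v" for u v using assms(1) by (simp add: inj_eq)
  obtain i where a: "a = Sig i \<or> a = SigInv i" by (cases a) auto
  then have i: "generator a = i" by auto
  consider "q = i" "y = Suc i" | "q = Suc i" "y = i"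
    | "\<not> (q = i \<and> y = Suc i)" "\<not> (q = Suc i \<and> y = i)" by blast
  then show ?thesis
  proof cases
    case 1
    then show ?thesis
      using a by (elim disjE) (simp_all add: left_of_def exchange_turns_def swap_adjacent_def s)
  next
    case 2
    then show ?thesis
      using a by (elim disjE) (simp_all add: left_of_def exchange_turns_def swap_adjacent_def s doubleton_eq_iff)
  next
    case 3
    have "swap_adjacent i q < swap_adjacent i y \<longleftrightarrow> q < y"
      using assms(2) 3 unfolding swap_adjacent_def by presburger
    moreover have "crossings s [a] (s q) (s y) = 0"
      using 3 a by (elim disjE) (simp_all add: s)
    moreover have "exchange_turns a q y = 0"
      using 3 by (auto simp: exchange_turns_def i doubleton_eq_iff)
    ultimately show ?thesis by (simp add: left_of_def i)
  qed
qed

lemma exchange_eq: "exchange i s = s \<circ> swap_adjacent i"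
  by (auto simp: exchange_def swap_adjacent_def)

lemma inj_exchange: "inj s \<Longrightarrow> inj (exchange i s)"
  unfolding exchange_eq
  by (rule inj_compose) (auto simp: swap_adjacent_def intro!: inj_on_inverseI[where g = "swap_adjacent i"])

text \<open>The angle swept around \<open>q\<close> by the image of \<open>p\<close> exceeds the one swept by \<open>p\<close> by the difference of the
  angles through which the vectors from \<open>q\<close> to the two end points of \<open>p\<close> turn. Here \<open>s\<close> names the
  strands that occupy the initial positions, and angles are counted in half turns. For the induction
  the image of \<open>p\<close> under the first letter takes the place of \<open>p\<close>.\<close>

lemma winding_number_braid:
  assumes "inj s" and p: "path p" "pathstart p = of_nat x" "pathfinish p = of_nat y"
    and q: "of_nat q \<notin> path_image p"
  shows "2 * Re (winding_number (braid_homeo w \<circ> p) (of_nat (final_position w q))) - 2 * Re (winding_number p (of_nat q)) =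
    (left_of (final_position w q) (final_position w y) - left_of q y - 2 * of_int (crossings s w (s q) (s y))) -
    (left_of (final_position w q) (final_position w x) - left_of q x - 2 * of_int (crossings s w (s q) (s x)))"
  using assms
proof (induction w arbitrary: s p x y q)
  case Nil
  then show ?case by simp
next
  case (Cons a w)
  define i where "i = generator a"
  define \<pi> where "\<pi> = swap_adjacent i"
  have neq: "q \<noteq> x" "q \<noteq> y"
    using Cons.prems pathstart_in_path_image[of p] pathfinish_in_path_image[of p] by auto
  have h: "letter_homeo a (of_nat j) = of_nat (\<pi> j)" for j
    by (simp add: letter_homeo_puncture \<pi>_def i_def)
  have inj: "letter_homeo a z = letter_homeo a z' \<longleftrightarrow> z = z'" for z z'
    by (simp add: letter_homeo_half_twist half_twist_eq_iff)
  have ex: "exchange i s (\<pi> j) = s j" for j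
    by (simp add: exchange_swap_adjacent \<pi>_def)
  have "path (letter_homeo a \<circ> p)"
    unfolding letter_homeo_half_twist
    by (rule path_continuous_image[OF Cons.prems(2) continuous_half_twist])
  moreover have "pathstart (letter_homeo a \<circ> p) = of_nat (\<pi> x)" "pathfinish (letter_homeo a \<circ> p) = of_nat (\<pi> y)"
    by (simp_all only: pathstart_compose pathfinish_compose Cons.prems(3,4) h)
  moreover have "of_nat (\<pi> q) \<notin> path_image (letter_homeo a \<circ> p)"
    using Cons.prems(5) by (simp only: path_image_compose h[symmetric]) (auto simp: inj)
  ultimately have IH: "2 * Re (winding_number (braid_homeo w \<circ> (letter_homeo a \<circ> p)) (of_nat (final_position w (\<pi> q)))) -
      2 * Re (winding_number (letter_homeo a \<circ> p) (of_nat (\<pi> q))) =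
    (left_of (final_position w (\<pi> q)) (final_position w (\<pi> y)) - left_of (\<pi> q) (\<pi> y) -
      2 * of_int (crossings (exchange i s) w (s q) (s y))) -
    (left_of (final_position w (\<pi> q)) (final_position w (\<pi> x)) - left_of (\<pi> q) (\<pi> x) -
      2 * of_int (crossings (exchange i s) w (s q) (s x)))"
    using Cons.IH[OF inj_exchange[OF Cons.prems(1), of i], of "letter_homeo a \<circ> p" "\<pi> x" "\<pi> y" "\<pi> q"]
    unfolding ex by blast
  have L: "2 * Re (winding_number (letter_homeo a \<circ> p) (of_nat (\<pi> q))) - 2 * Re (winding_number p (of_nat q)) =
      exchange_turns a q y - exchange_turns a q x"
    using winding_number_letter[OF Cons.prems(2-5), of a] unfolding h .
  have comp: "braid_homeo (a # w) \<circ> p = braid_homeo w \<circ> (letter_homeo a \<circ> p)"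
    by (simp add: fun_eq_iff)
  have final: "final_position (a # w) j = final_position w (\<pi> j)" for j
    by (simp add: \<pi>_def i_def)
  show ?case
    using IH L unfolding comp final crossings_Cons[of s a w] i_def[symmetric]
      exchange_turns_crossings[OF Cons.prems(1) neq(1), of a, folded i_def \<pi>_def]
      exchange_turns_crossings[OF Cons.prems(1) neq(2), of a, folded i_def \<pi>_def]
      of_int_add by argo
qed

theorem corollary1:
  fixes n :: nat and A :: "nat \<Rightarrow> nat \<Rightarrow> int" and b :: "letter list set"
  assumes "n \<ge> 3"
    and "b \<in> braids n" and "pure_braid b" and "reducible_braid n b"
    and "\<forall>i\<in>{1..n}. \<forall>j\<in>{1..n}. A i j = crossing_matrix b i j"
  shows "\<exists>S. S \<subseteq> {1..n} \<and> 1 < card S \<and> card S < n \<and>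
    (\<forall>k\<in>{1..n} - S. \<exists>l\<in>S. \<exists>l'\<in>S. l \<noteq> l' \<and> A k l = A k l')"
proof -
  obtain h F where "h \<in> mapping_class n b" "F \<noteq> {}"
    and F: "\<And>C. C \<in> F \<Longrightarrow> essential_curve n C" "pairwise disjnt F"
      "\<And>C. C \<in> F \<Longrightarrow> \<exists>C'\<in>F. isotopic_curves n (h ` C) C'"
    using assms(4) unfolding reducible_braid_def by blast
  then obtain w where "w \<in> b"
    and wh: "homotopic_with_canon (punctured_disk_homeo n) (disk n) (disk n) (braid_homeo w) h"
    unfolding mapping_class_def by blast
  obtain C C' where "C \<in> F" "C' \<in> F" and iso': "isotopic_curves n (h ` C) C'"
    using \<open>F \<noteq> {}\<close> F(3) by blast
  then have CC': "C = C' \<or> C \<inter> C' = {}"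
    using F(2) by (auto simp: pairwise_def disjnt_def)
  have jordan: "jordan_curve C" "jordan_curve C'" and avoid: "C \<subseteq> disk n - punctures n" "C' \<subseteq> disk n - punctures n"
    and card: "2 \<le> card (inside C \<inter> punctures n)" "card (inside C \<inter> punctures n) \<le> n - 1"
    using F(1)[OF \<open>C \<in> F\<close>] F(1)[OF \<open>C' \<in> F\<close>] by (auto simp: essential_curve_def jordan_curve_def)
  have pure: "final_position w j = j" for j
    using arrangement_final_position[of id w j] pure_braid_iff[OF assms(2) \<open>w \<in> b\<close>] assms(3) by simp
  then have fixed_puncture: "braid_homeo w (of_nat j) = of_nat j" for j
    by (simp add: braid_homeo_puncture)
  obtain g where f: "homeomorphism UNIV UNIV (braid_homeo w) g"
    using homeomorphism_braid_homeo by blast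
  note iso = isotopic_homeo_image_curves[OF wh jordan(1) avoid(1)]
  define S where "S = {j \<in> {1..n}. of_nat j \<in> inside C}"
  have "inside C \<inter> punctures n = of_nat ` S"
    by (auto simp: S_def punctures_def)
  then have "card (inside C \<inter> punctures n) = card S"
    by (simp add: card_image inj_on_def)
  then have "1 < card S" "card S < n" using card assms(1) by linarith+
  have eq: "A k l = A k l'" if k: "k \<in> {1..n} - S" and l: "l \<in> S" "l' \<in> S" for k l l'
  proof -
    let ?f = "braid_homeo w" and ?q = "of_nat k :: complex" and ?x = "of_nat l :: complex" and ?y = "of_nat l' :: complex"
    have P: "?q \<in> punctures n" "?x \<in> punctures n" "?y \<in> punctures n"
      using k l by (auto simp: punctures_def S_def)
    have C: "?q \<notin> inside C" "?x \<in> inside C" "?y \<in> inside C"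
      using k l by (auto simp: S_def)
    have inside_f: "inside (?f ` C) = ?f ` inside C"
      by (rule homeomorphic_image_inside[OF f jordan(1)])
    have inj_f: "inj ?f"
      using f by (auto simp: homeomorphism_def intro: inj_on_inverseI)
    have mem_image: "of_nat j \<in> ?f ` X \<longleftrightarrow> of_nat j \<in> X" for j X
      using inj_image_mem_iff[OF inj_f, of "of_nat j" X] unfolding fixed_puncture .
    have fC: "?q \<notin> inside (?f ` C)" "?x \<in> inside (?f ` C)" "?y \<in> inside (?f ` C)"
      unfolding inside_f mem_image by (fact C)+
    have "?q \<notin> ?f ` C"
      unfolding mem_image using P(1) avoid(1) by blast
    note hC = fC[unfolded isotopic_curves_inside[OF iso P(1)] isotopic_curves_inside[OF iso P(2)]
        isotopic_curves_inside[OF iso P(3)]]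
    note C' = hC[unfolded isotopic_curves_inside[OF iso' P(1)] isotopic_curves_inside[OF iso' P(2)]
        isotopic_curves_inside[OF iso' P(3)]]
    have out: "?q \<in> outside C" "?q \<in> outside C'" "?q \<in> outside (?f ` C)"
      using C(1) C'(1) fC(1) avoid P(1) \<open>?q \<notin> ?f ` C\<close> by (auto simp: outside_inside)
    obtain p where p: "path p" "path_image p \<subseteq> inside C" "pathstart p = ?x" "pathfinish p = ?y"
      using path_inside_jordan_curve[OF jordan(1) C(2,3)] .
    have "path (?f \<circ> p)"
      using f p(1) by (intro path_continuous_image) (auto simp: homeomorphism_def intro: continuous_on_subset)
    moreover have "path_image (?f \<circ> p) \<subseteq> inside (?f ` C)"
      unfolding inside_f path_image_compose using p(2) by blast
    ultimately have "winding_number (?f \<circ> p) ?q = turning (?f ` C) ?q ?x ?y"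
      using winding_number_turning[OF _ _ out(3)] p(3,4) fixed_puncture by (simp add: pathstart_compose pathfinish_compose)
    also have "\<dots> = turning (h ` C) ?q ?x ?y"
      using isotopic_curves_turning[OF iso P fC] .
    also have "\<dots> = turning C' ?q ?x ?y"
      using isotopic_curves_turning[OF iso' P hC] .
    also have "\<dots> = turning C ?q ?x ?y"
      using turning_disjoint[OF jordan CC' out(1,2) C(2,3) C'(2,3)] by simp
    also have "\<dots> = winding_number p ?q"
      using winding_number_turning[OF p(1,2) out(1)] p(3,4) by simp
    finally have "crossings id w k l = crossings id w k l'"
      using winding_number_braid[of id p l l' k w] p C(1) pure by auto
    then show ?thesis
      using assms(5) k l crossing_matrix_eq[OF assms(2) \<open>w \<in> b\<close>] by (simp add: S_def)
  qed
  have "finite S" "S \<subseteq> {1..n}" by (auto simp: S_def)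
  obtain l l' where "l \<in> S" "l' \<in> S" "l \<noteq> l'"
  proof -
    have "\<not> card S \<le> Suc 0" using \<open>1 < card S\<close> by simp
    then show ?thesis using that unfolding card_le_Suc0_iff_eq[OF \<open>finite S\<close>] by blast
  qed
  then show ?thesis
    using \<open>S \<subseteq> {1..n}\<close> \<open>1 < card S\<close> \<open>card S < n\<close> eq by blast
qed

end
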